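(* Let $n\ge 1$ and $k\ge 2$ be integers. There exists a generic set $\Omega\subset (\mathbb{C}^{(n+k-1)\times n})^k$ with the following properties: 1) For each $(B_1,\dots,B_k)\in\Omega$ there exists a generic set $\Theta\subset(\mathbb{C}^{n\times(n+k-1)})^k$ such that the $n^k\times n^k$ operator determinant $$\Delta_0=\left|\begin{matrix}P_1B_1&\cdots&P_1B_k\\ \vdots&&\vdots\\ P_kB_1&\cdots&P_kB_k\end{matrix}\right|_\otimes=\sum_{\sigma\in S_k}\operatorname{sgn}(\sigma)\,(P_1B_{\sigma(1)})\otimes(P_2B_{\sigma(2)})\otimes\cdots\otimes(P_kB_{\sigma(k)})$$ is nonsingular for all $(P_1,\dots,P_k)\in\Theta$. 2) For each $(B_1,\dots,B_k)\in\Omega$ it holds that $\operatorname{rank}(\lambda_1B_1+\cdots+\lambda_kB_k)=n$ for all $(\lambda_1,\dots,\lambda_k)\in\mathbb{C}^k\setminus\{0\}$.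
   Context: A set $\mathcal{S}\subseteq\mathbb{C}^r$ is called an algebraic variety if it is the set of common zeros of finitely many complex polynomials in $r$ variables, and it is called proper if $\mathcal{S}\neq\mathbb{C}^r$. A set $\Omega\subset\mathbb{C}^r$ is called generic if its complement is contained in a proper algebraic variety. Spaces of tuples of matrices are identified with $\mathbb{C}^r$ via the matrix entries. The symbol $\otimes$ denotes the Kronecker product and $S_k$ the symmetric group on $\{1,\dots,k\}$. *)

theory Defs
  imports
    Complex_Main
    "HOL-Library.Poly_Mapping"
    "HOL-Combinatorics.Permutations"
    "Jordan_Normal_Form.Matrix"
    "Jordan_Normal_Form.DL_Rank"
begin

section \<open>Algebraic varieties and generic sets in complex affine space\<close>

text \<open>A polynomial is a finitely supported map from exponent vectors to coefficients;
  the variables are indexed by natural numbers, starting from 0.\<close>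

type_synonym cpoly = "(nat \<Rightarrow>\<^sub>0 nat) \<Rightarrow>\<^sub>0 complex"

definition cpoly_vars :: "cpoly \<Rightarrow> nat set" where
  "cpoly_vars p = (\<Union>m \<in> Poly_Mapping.keys p. Poly_Mapping.keys m)"

definition cpoly_eval :: "cpoly \<Rightarrow> complex vec \<Rightarrow> complex" where
  "cpoly_eval p x =
     (\<Sum>m \<in> Poly_Mapping.keys p.
        Poly_Mapping.lookup p m * (\<Prod>i \<in> Poly_Mapping.keys m. (x $ i) ^ Poly_Mapping.lookup m i))"

definition algebraic_variety :: "nat \<Rightarrow> complex vec set \<Rightarrow> bool" where
  "algebraic_variety r S \<longleftrightarrow>
     (\<exists>F :: cpoly set. finite F \<and> (\<forall>p \<in> F. cpoly_vars p \<subseteq> {..<r}) \<and>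
        S = {x \<in> carrier_vec r. \<forall>p \<in> F. cpoly_eval p x = 0})"

definition proper_variety :: "nat \<Rightarrow> complex vec set \<Rightarrow> bool" where
  "proper_variety r S \<longleftrightarrow> algebraic_variety r S \<and> S \<noteq> carrier_vec r"

definition generic :: "nat \<Rightarrow> complex vec set \<Rightarrow> bool" where
  "generic r \<Omega> \<longleftrightarrow> \<Omega> \<subseteq> carrier_vec r \<and> (\<exists>S. proper_variety r S \<and> carrier_vec r - \<Omega> \<subseteq> S)"


section \<open>Tuples of matrices as points of affine space\<close>

definition mat_tuples :: "nat \<Rightarrow> nat \<Rightarrow> nat \<Rightarrow> 'a mat list set" where
  "mat_tuples k nr nc = {Ms. length Ms = k \<and> set Ms \<subseteq> carrier_mat nr nc}"

text \<open>The entries are listed matrix by matrix, and row by row within each matrix.\<close>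

definition vec_of_mats :: "nat \<Rightarrow> nat \<Rightarrow> nat \<Rightarrow> 'a mat list \<Rightarrow> 'a vec" where
  "vec_of_mats k nr nc Ms =
     vec (k * (nr * nc)) (\<lambda>t. (Ms ! (t div (nr * nc))) $$ (t mod (nr * nc) div nc, t mod (nr * nc) mod nc))"

lemma bij_betw_vec_of_mats:
  "bij_betw (vec_of_mats k nr nc) (mat_tuples k nr nc) (carrier_vec (k * (nr * nc)) :: 'a vec set)"
proof -
  define N where "N = nr * nc"
  define g :: "'a vec \<Rightarrow> 'a mat list" where
    "g v = map (\<lambda>a. mat nr nc (\<lambda>(i, j). v $ (a * N + (i * nc + j)))) [0..<k]" for v
  have small: "i * nc + j < N" if "i < nr" "j < nc" for i j
  proof -
    have "i * nc + j < Suc i * nc" using that by simp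
    also have "\<dots> \<le> nr * nc" using that by (intro mult_le_mono1) simp
    finally show ?thesis by (simp add: N_def)
  qed
  have idx: "a * N + (i * nc + j) < k * N" if "a < k" "i < nr" "j < nc" for a i j
  proof -
    have "a * N + (i * nc + j) < Suc a * N" using small[OF that(2,3)] by simp
    also have "\<dots> \<le> k * N" using that by (intro mult_le_mono1) simp
    finally show ?thesis .
  qed
  have divN: "(a * N + (i * nc + j)) div N = a" "(a * N + (i * nc + j)) mod N = i * nc + j"
    if "i < nr" "j < nc" for a i j
    using small[OF that] by auto
  show ?thesis
  proof (rule bij_betw_byWitness[where f' = g])
    show "\<forall>Ms \<in> mat_tuples k nr nc. g (vec_of_mats k nr nc Ms) = Ms"
    proof
      fix Ms :: "'a mat list"
      assume Ms: "Ms \<in> mat_tuples k nr nc"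
      then have len: "length Ms = k" and car: "\<And>a. a < k \<Longrightarrow> Ms ! a \<in> carrier_mat nr nc"
        by (auto simp: mat_tuples_def)
      show "g (vec_of_mats k nr nc Ms) = Ms"
      proof (rule nth_equalityI)
        show "length (g (vec_of_mats k nr nc Ms)) = length Ms" by (simp add: g_def len)
      next
        fix a assume "a < length (g (vec_of_mats k nr nc Ms))"
        then have a: "a < k" by (simp add: g_def)
        show "g (vec_of_mats k nr nc Ms) ! a = Ms ! a"
        proof (rule eq_matI)
          fix i j assume "i < dim_row (Ms ! a)" "j < dim_col (Ms ! a)"
          then have ij: "i < nr" "j < nc" using car[OF a] by auto
          show "g (vec_of_mats k nr nc Ms) ! a $$ (i, j) = Ms ! a $$ (i, j)"
            using a ij idx[OF a ij] divN[OF ij, of a]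
            by (simp add: g_def vec_of_mats_def flip: N_def)
        qed (use a car[OF a] in \<open>auto simp: g_def\<close>)
      qed
    qed
    show "\<forall>v \<in> carrier_vec (k * (nr * nc)). vec_of_mats k nr nc (g v) = v"
    proof
      fix v :: "'a vec" assume v: "v \<in> carrier_vec (k * (nr * nc))"
      show "vec_of_mats k nr nc (g v) = v"
      proof (rule eq_vecI)
        fix t assume "t < dim_vec v"
        then have t: "t < k * N" using v by (auto simp: N_def)
        then have N0: "N > 0" by (cases N) auto
        then have nc0: "nc > 0" and "nr > 0" by (auto simp: N_def)
        have a: "t div N < k" using t N0 by (simp add: less_mult_imp_div_less)
        have m: "t mod N < nr * nc" using N0 by (simp add: N_def)
        then have i: "t mod N div nc < nr" by (simp add: less_mult_imp_div_less)
        have j: "t mod N mod nc < nc" using nc0 by simp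
        have "t div N * N + (t mod N div nc * nc + t mod N mod nc) = t"
          by simp
        then show "vec_of_mats k nr nc (g v) $ t = v $ t"
          using t a i j by (simp add: vec_of_mats_def g_def flip: N_def)
      qed (use v in \<open>auto simp: vec_of_mats_def\<close>)
    qed
    show "vec_of_mats k nr nc ` mat_tuples k nr nc \<subseteq> carrier_vec (k * (nr * nc))"
      by (auto simp: vec_of_mats_def)
    show "g ` carrier_vec (k * (nr * nc)) \<subseteq> mat_tuples k nr nc"
      by (auto simp: g_def mat_tuples_def)
  qed
qed

definition generic_mats :: "nat \<Rightarrow> nat \<Rightarrow> nat \<Rightarrow> complex mat list set \<Rightarrow> bool" where
  "generic_mats k nr nc \<Omega> \<longleftrightarrow>
     \<Omega> \<subseteq> mat_tuples k nr nc \<and> generic (k * (nr * nc)) (vec_of_mats k nr nc ` \<Omega>)"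


section \<open>Kronecker products and operator determinants\<close>

definition kronecker :: "'a :: semiring_1 mat \<Rightarrow> 'a mat \<Rightarrow> 'a mat" (infixr \<open>\<otimes>\<^sub>K\<close> 70) where
  "A \<otimes>\<^sub>K B = mat (dim_row A * dim_row B) (dim_col A * dim_col B)
     (\<lambda>(i, j). A $$ (i div dim_row B, j div dim_col B) * B $$ (i mod dim_row B, j mod dim_col B))"

definition kronecker_list :: "'a :: semiring_1 mat list \<Rightarrow> 'a mat" where
  "kronecker_list As = foldr (\<otimes>\<^sub>K) As (1\<^sub>m 1)"

lemma kronecker_carrier:
  "A \<in> carrier_mat a b \<Longrightarrow> B \<in> carrier_mat c d \<Longrightarrow> A \<otimes>\<^sub>K B \<in> carrier_mat (a * c) (b * d)"
  by (auto simp: kronecker_def)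

lemma kronecker_list_carrier:
  "set As \<subseteq> carrier_mat n n \<Longrightarrow> kronecker_list As \<in> carrier_mat (n ^ length As) (n ^ length As)"
  by (induction As) (auto simp: kronecker_list_def intro!: kronecker_carrier)

lemma kronecker_list_singleton: "kronecker_list [A] = A"
  by (rule eq_matI) (auto simp: kronecker_list_def kronecker_def)

text \<open>As for \<open>finsum_vec\<close>, the value is meaningful only if all summands on the (finite) index
  set lie in the carrier.\<close>

definition finsum_mat :: "'a :: monoid_add itself \<Rightarrow> nat \<Rightarrow> nat \<Rightarrow> ('c \<Rightarrow> 'a mat) \<Rightarrow> 'c set \<Rightarrow> 'a mat" where
  "finsum_mat ty nr nc = finprod (monoid_mat ty nr nc)"

lemma finsum_mat_carrier_index:
  fixes f :: "'c \<Rightarrow> 'a :: comm_monoid_add mat"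
  assumes "finite S" "\<And>s. s \<in> S \<Longrightarrow> f s \<in> carrier_mat nr nc"
  shows "finsum_mat TYPE('a) nr nc f S \<in> carrier_mat nr nc \<and>
    (\<forall>i < nr. \<forall>j < nc. finsum_mat TYPE('a) nr nc f S $$ (i, j) = (\<Sum>s\<in>S. f s $$ (i, j)))"
proof -
  interpret comm_monoid "monoid_mat TYPE('a) nr nc" by (rule comm_monoid_mat)
  show ?thesis
    using assms
  proof (induction S rule: finite_induct)
    case empty
    show ?case by (simp add: finsum_mat_def) (simp add: monoid_mat_def)
  next
    case (insert s S)
    then have "finsum_mat TYPE('a) nr nc f (insert s S) = f s + finsum_mat TYPE('a) nr nc f S"
      unfolding finsum_mat_def by (subst finprod_insert) (auto simp: monoid_mat_def)
    with insert show ?case by auto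
  qed
qed

text \<open>The operator determinant of a \<open>k\<close> by \<open>k\<close> array of \<open>n\<close> by \<open>n\<close> matrices; the array is
  indexed from 0.\<close>

definition operator_det :: "nat \<Rightarrow> nat \<Rightarrow> (nat \<Rightarrow> nat \<Rightarrow> 'a :: comm_ring_1 mat) \<Rightarrow> 'a mat" where
  "operator_det k n A =
     finsum_mat TYPE('a) (n ^ k) (n ^ k)
       (\<lambda>\<sigma>. of_int (sign \<sigma>) \<cdot>\<^sub>m kronecker_list (map (\<lambda>i. A i (\<sigma> i)) [0..<k]))
       {\<sigma>. \<sigma> permutes {..<k}}"

end

(* If a nonzero combination of the B_j kills a vector x, the operator determinant kills the tensor
   power of x; so nonsingularity of Delta_0 for a single tuple P already forces the rank condition,
   and both parts follow once det Delta_0 is not the zero polynomial in (P, B). For that, let the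
   rows of the P_i be powers of distinct nodes and let the B_j be shifted identity blocks: Delta_0
   becomes a diagonal matrix of Vandermonde determinants times a Kronecker product of Vandermonde
   matrices. *)

theory Submission
  imports Defs
begin

section \<open>Polynomial functions\<close>

text \<open>Everything rests on an entrywise reading of Delta_0. Write the row index I and the
  column index J with k digits in base n. Then the entry (I, J) is an ordinary k by k determinant,
  whose entry (a, b) is the scalar of P_a B_b in row "digit a of I" and column "digit a of J". If
  every block is replaced by copies of its image of x, the digits of J disappear, and a relation
  between the vectors B_b x makes the columns of that scalar determinant dependent. For blocks with
  entries t^(s + j), the digits of J enter row a only as a common factor, which separates J from the
  determinant. The size n + k - 1 is the number of exponents s + j with s < n and j < k, so the
  shifted identity blocks just fit. One fixed tuple P0 serves both parts: it defines Omega, and for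
  each B in Omega it is the point where the polynomial defining Theta does not vanish.\<close>

definition monom_eval :: "(nat \<Rightarrow>\<^sub>0 nat) \<Rightarrow> complex vec \<Rightarrow> complex" where
  "monom_eval m x = (\<Prod>i \<in> Poly_Mapping.keys m. (x $ i) ^ Poly_Mapping.lookup m i)"

text \<open>Distinct exponent vectors have distinct key sets in general. Passing to a common finite
  set adds only factors with exponent 0 and makes the products comparable.\<close>

lemma monom_eval_superset:
  assumes "finite I" "Poly_Mapping.keys m \<subseteq> I"
  shows "monom_eval m x = (\<Prod>i\<in>I. (x $ i) ^ Poly_Mapping.lookup m i)"
  unfolding monom_eval_def using assms
  by (intro prod.mono_neutral_left) (auto simp: in_keys_iff)

lemma monom_eval_add: "monom_eval (m + m') x = monom_eval m x * monom_eval m' x"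
proof -
  let ?I = "Poly_Mapping.keys m \<union> Poly_Mapping.keys m'"
  have "monom_eval (m + m') x = (\<Prod>i\<in>?I. (x $ i) ^ Poly_Mapping.lookup (m + m') i)"
    using Poly_Mapping.keys_add[of m m'] by (intro monom_eval_superset) auto
  also have "\<dots> = (\<Prod>i\<in>?I. (x $ i) ^ Poly_Mapping.lookup m i) * (\<Prod>i\<in>?I. (x $ i) ^ Poly_Mapping.lookup m' i)"
    by (simp add: lookup_add power_add prod.distrib)
  finally show ?thesis
    by (simp add: monom_eval_superset[of ?I])
qed

text \<open>Coefficients can cancel in \<open>p + q\<close>, so its keys may be fewer than those of
  the summands; over a common superset the extra terms have coefficient 0.\<close>

lemma cpoly_eval_superset:
  assumes "finite M" "Poly_Mapping.keys p \<subseteq> M"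
  shows "cpoly_eval p x = (\<Sum>m\<in>M. Poly_Mapping.lookup p m * monom_eval m x)"
  unfolding cpoly_eval_def monom_eval_def using assms
  by (intro sum.mono_neutral_left) (auto simp: in_keys_iff)

lemma cpoly_eval_add: "cpoly_eval (p + q) x = cpoly_eval p x + cpoly_eval q x"
proof -
  let ?M = "Poly_Mapping.keys p \<union> Poly_Mapping.keys q"
  have "cpoly_eval (p + q) x = (\<Sum>m\<in>?M. Poly_Mapping.lookup (p + q) m * monom_eval m x)"
    using Poly_Mapping.keys_add[of p q] by (intro cpoly_eval_superset) auto
  then show ?thesis
    by (simp add: cpoly_eval_superset[of ?M] lookup_add algebra_simps sum.distrib)
qed

lemma cpoly_eval_single: "cpoly_eval (Poly_Mapping.single m c) x = c * monom_eval m x"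
  by (subst cpoly_eval_superset[of "{m}"]) auto

lemma cpoly_eval_sum: "cpoly_eval (\<Sum>s\<in>S. p s) x = (\<Sum>s\<in>S. cpoly_eval (p s) x)"
  by (induction S rule: infinite_finite_induct)
     (auto simp: cpoly_eval_add, simp_all add: cpoly_eval_def)

lemma cpoly_eq_sum_single:
  "(p :: cpoly) = (\<Sum>m\<in>Poly_Mapping.keys p. Poly_Mapping.single m (Poly_Mapping.lookup p m))"
  by (rule poly_mapping_eqI) (auto simp: lookup_sum lookup_single when_def in_keys_iff)

text \<open>Both factors are split into single terms: \<open>mult_single\<close> multiplies terms by
  adding exponents, and \<open>monom_eval\<close> turns that addition into a product.\<close>

lemma cpoly_eval_mult: "cpoly_eval (p * q) x = cpoly_eval p x * cpoly_eval q x"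
proof -
  have "p * q = (\<Sum>m\<in>Poly_Mapping.keys p. \<Sum>m'\<in>Poly_Mapping.keys q.
    Poly_Mapping.single (m + m') (Poly_Mapping.lookup p m * Poly_Mapping.lookup q m'))"
    unfolding mult_single[symmetric] sum_product[symmetric]
    by (simp only: cpoly_eq_sum_single[symmetric])
  then have "cpoly_eval (p * q) x = (\<Sum>m\<in>Poly_Mapping.keys p. \<Sum>m'\<in>Poly_Mapping.keys q.
    (Poly_Mapping.lookup p m * monom_eval m x) * (Poly_Mapping.lookup q m' * monom_eval m' x))"
    by (simp add: cpoly_eval_sum cpoly_eval_single monom_eval_add algebra_simps)
  also have "\<dots> = cpoly_eval p x * cpoly_eval q x"
    unfolding cpoly_eval_def monom_eval_def sum_product ..
  finally show ?thesis .
qed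

lemma cpoly_vars_add: "cpoly_vars (p + q) \<subseteq> cpoly_vars p \<union> cpoly_vars q"
  using Poly_Mapping.keys_add[of p q] by (auto simp: cpoly_vars_def)

lemma cpoly_vars_mult: "cpoly_vars (p * q) \<subseteq> cpoly_vars p \<union> cpoly_vars q"
proof -
  have "Poly_Mapping.keys m \<subseteq> cpoly_vars p \<union> cpoly_vars q" if "m \<in> Poly_Mapping.keys (p * q)" for m
  proof -
    from that Poly_Mapping.keys_mult[of p q] obtain m1 m2 where
      "m = m1 + m2" "m1 \<in> Poly_Mapping.keys p" "m2 \<in> Poly_Mapping.keys q" by auto
    then show ?thesis
      using Poly_Mapping.keys_add[of m1 m2] by (auto simp: cpoly_vars_def)
  qed
  then show ?thesis unfolding cpoly_vars_def[of "p * q"] by blast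
qed

text \<open>Only the existence of a polynomial is recorded, so polynomiality of a determinant
  follows from closure rules while its polynomial is never written down.\<close>

definition polynomial_on :: "nat \<Rightarrow> (complex vec \<Rightarrow> complex) \<Rightarrow> bool" where
  "polynomial_on r f \<longleftrightarrow>
     (\<exists>p. cpoly_vars p \<subseteq> {..<r} \<and> (\<forall>x \<in> carrier_vec r. f x = cpoly_eval p x))"

lemma polynomial_on_const: "polynomial_on r (\<lambda>_. c)"
  unfolding polynomial_on_def
  by (intro exI[of _ "Poly_Mapping.single 0 c"])
     (auto simp: cpoly_eval_single monom_eval_def cpoly_vars_def)

lemma polynomial_on_coord: "i < r \<Longrightarrow> polynomial_on r (\<lambda>x. x $ i)"
  unfolding polynomial_on_def
  by (intro exI[of _ "Poly_Mapping.single (Poly_Mapping.single i 1) 1"])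
     (auto simp: cpoly_eval_single monom_eval_def cpoly_vars_def)

lemma polynomial_on_add:
  assumes "polynomial_on r f" "polynomial_on r g"
  shows "polynomial_on r (\<lambda>x. f x + g x)"
proof -
  obtain p q where "cpoly_vars p \<subseteq> {..<r}" "\<forall>x \<in> carrier_vec r. f x = cpoly_eval p x"
    "cpoly_vars q \<subseteq> {..<r}" "\<forall>x \<in> carrier_vec r. g x = cpoly_eval q x"
    using assms unfolding polynomial_on_def by blast
  then show ?thesis unfolding polynomial_on_def
    using cpoly_vars_add[of p q] by (intro exI[of _ "p + q"]) (auto simp: cpoly_eval_add)
qed

lemma polynomial_on_mult:
  assumes "polynomial_on r f" "polynomial_on r g"
  shows "polynomial_on r (\<lambda>x. f x * g x)"
proof -
  obtain p q where "cpoly_vars p \<subseteq> {..<r}" "\<forall>x \<in> carrier_vec r. f x = cpoly_eval p x"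
    "cpoly_vars q \<subseteq> {..<r}" "\<forall>x \<in> carrier_vec r. g x = cpoly_eval q x"
    using assms unfolding polynomial_on_def by blast
  then show ?thesis unfolding polynomial_on_def
    using cpoly_vars_mult[of p q] by (intro exI[of _ "p * q"]) (auto simp: cpoly_eval_mult)
qed

lemma polynomial_on_sum:
  "(\<And>s. s \<in> S \<Longrightarrow> polynomial_on r (f s)) \<Longrightarrow> polynomial_on r (\<lambda>x. \<Sum>s\<in>S. f s x)"
  by (induction S rule: infinite_finite_induct)
     (auto intro: polynomial_on_add polynomial_on_const)

lemma polynomial_on_prod:
  "(\<And>s. s \<in> S \<Longrightarrow> polynomial_on r (f s)) \<Longrightarrow> polynomial_on r (\<lambda>x. \<Prod>s\<in>S. f s x)"
  by (induction S rule: infinite_finite_induct)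
     (auto intro: polynomial_on_mult polynomial_on_const)

text \<open>Leibniz expansion. The dimension is required for every \<open>x\<close>, even outside
  \<open>carrier_vec r\<close>, because the expansion is rewritten under the binder.\<close>

lemma polynomial_on_det:
  assumes dim: "\<And>x. A x \<in> carrier_mat m m"
    and entry: "\<And>i j. i < m \<Longrightarrow> j < m \<Longrightarrow> polynomial_on r (\<lambda>x. A x $$ (i, j))"
  shows "polynomial_on r (\<lambda>x. det (A x))"
  unfolding det_def'[OF dim]
proof (intro polynomial_on_sum polynomial_on_mult polynomial_on_const polynomial_on_prod entry)
  fix p i assume "p \<in> {p. p permutes {0..<m}}" "i \<in> {0..<m}"
  then show "i < m" "p i < m"
    using permutes_in_image[of p "{0..<m}" i] by auto
qed

section \<open>Nonvanishing loci of polynomials are generic\<close>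

lemma generic_nonvanishing:
  assumes f: "polynomial_on r f" and x0: "x0 \<in> carrier_vec r" "f x0 \<noteq> 0"
  shows "generic r {x \<in> carrier_vec r. f x \<noteq> 0}"
proof -
  obtain p where p: "cpoly_vars p \<subseteq> {..<r}" "\<forall>x \<in> carrier_vec r. f x = cpoly_eval p x"
    using f unfolding polynomial_on_def by blast
  \<comment> \<open>The single polynomial \<open>p\<close> cuts out the complement, and
    \<open>x0\<close> lies outside its zero set.\<close>
  have "proper_variety r {x \<in> carrier_vec r. cpoly_eval p x = 0}"
    unfolding proper_variety_def algebraic_variety_def
    using p x0 by (auto intro!: exI[of _ "{p}"])
  then show ?thesis unfolding generic_def using p by auto
qed

text \<open>Since flattening is onto the affine space, the image of the nonvanishing tuples is the
  whole nonvanishing locus of \<open>f\<close>.\<close>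

lemma generic_mats_nonvanishing:
  assumes f: "polynomial_on (k * (nr * nc)) f"
    and M0: "M0 \<in> mat_tuples k nr nc" "f (vec_of_mats k nr nc M0) \<noteq> 0"
  shows "generic_mats k nr nc {Ms \<in> mat_tuples k nr nc. f (vec_of_mats k nr nc Ms) \<noteq> 0}"
proof -
  let ?v = "vec_of_mats k nr nc :: complex mat list \<Rightarrow> complex vec"
  have bij: "?v ` mat_tuples k nr nc = carrier_vec (k * (nr * nc))"
    using bij_betw_vec_of_mats by (rule bij_betw_imp_surj_on)
  have "?v ` {Ms \<in> mat_tuples k nr nc. f (?v Ms) \<noteq> 0} = {x \<in> ?v ` mat_tuples k nr nc. f x \<noteq> 0}"
    by auto
  moreover have "?v M0 \<in> carrier_vec (k * (nr * nc))"
    unfolding bij[symmetric] using M0(1) by (rule imageI)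
  ultimately show ?thesis
    unfolding generic_mats_def bij using generic_nonvanishing[OF f _ M0(2)] by simp
qed

lemma vec_of_mats_nth:
  assumes "a < k" "i < nr" "j < nc"
  shows "a * (nr * nc) + (i * nc + j) < k * (nr * nc)"
    and "vec_of_mats k nr nc Ms $ (a * (nr * nc) + (i * nc + j)) = Ms ! a $$ (i, j)"
proof -
  have "i * nc + j < Suc i * nc" using assms by simp
  also have "\<dots> \<le> nr * nc" using assms by (intro mult_le_mono1) simp
  finally have small: "i * nc + j < nr * nc" .
  have "a * (nr * nc) + (i * nc + j) < Suc a * (nr * nc)" using small by simp
  also have "\<dots> \<le> k * (nr * nc)" using assms by (intro mult_le_mono1) simp
  finally show less: "a * (nr * nc) + (i * nc + j) < k * (nr * nc)" .
  show "vec_of_mats k nr nc Ms $ (a * (nr * nc) + (i * nc + j)) = Ms ! a $$ (i, j)"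
    using less small assms by (simp add: vec_of_mats_def)
qed

section \<open>Kronecker products and operator determinants\<close>

text \<open>Digits are counted from the most significant one, the order in which \<open>kronecker_list\<close> nests.\<close>

definition digit :: "nat \<Rightarrow> nat \<Rightarrow> nat \<Rightarrow> nat \<Rightarrow> nat" where
  "digit n k a I = I div n ^ (k - Suc a) mod n"

lemma digit_less: "n > 0 \<Longrightarrow> digit n k a I < n"
  by (simp add: digit_def)

text \<open>Reduction modulo \<open>n ^ k\<close> strips the leading digit and shifts the others by
  one, just as removing the head of the list does in \<open>kronecker_list\<close>.\<close>

lemma digit_Suc:
  assumes "n > 0" "a < k"
  shows "digit n (Suc k) (Suc a) I = digit n k a (I mod n ^ k)"
proof -
  let ?m = "n ^ (k - Suc a)"
  have k: "n ^ k = ?m * n ^ Suc a"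
    using assms by (simp only: flip: power_add) simp
  have "I mod n ^ k div ?m = I div ?m mod n ^ Suc a"
    using assms unfolding k mod_mult2_eq by simp
  then show ?thesis
    by (simp add: digit_def mod_mod_cancel)
qed

lemma digit_0: "I < n ^ Suc k \<Longrightarrow> digit n (Suc k) 0 I = I div n ^ k"
  by (simp add: digit_def less_mult_imp_div_less)

lemma kronecker_list_index:
  fixes As :: "'a :: comm_semiring_1 mat list"
  assumes "n > 0" "set As \<subseteq> carrier_mat n n" "I < n ^ length As" "J < n ^ length As"
  shows "kronecker_list As $$ (I, J) =
    (\<Prod>a<length As. As ! a $$ (digit n (length As) a I, digit n (length As) a J))"
  using assms(2-)
proof (induction As arbitrary: I J)
  case Nil
  then show ?case by (simp add: kronecker_list_def)
next
  case (Cons A As)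
  let ?k = "length As"
  have K: "kronecker_list As \<in> carrier_mat (n ^ ?k) (n ^ ?k)"
    using Cons.prems by (intro kronecker_list_carrier) simp
  have "kronecker_list (A # As) $$ (I, J) =
    A $$ (I div n ^ ?k, J div n ^ ?k) * kronecker_list As $$ (I mod n ^ ?k, J mod n ^ ?k)"
    using Cons.prems K by (auto simp: kronecker_list_def kronecker_def)
  also have "kronecker_list As $$ (I mod n ^ ?k, J mod n ^ ?k) =
    (\<Prod>a<?k. As ! a $$ (digit n ?k a (I mod n ^ ?k), digit n ?k a (J mod n ^ ?k)))"
    using Cons.prems assms(1) by (intro Cons.IH) auto
  finally show ?case
    using Cons.prems assms(1) by (simp add: prod.lessThan_Suc_shift digit_0 digit_Suc del: prod.lessThan_Suc)
qed

section \<open>Mixed products and inverses of Kronecker products\<close>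

lemma sum_div_mod:
  fixes g :: "nat \<Rightarrow> nat \<Rightarrow> 'a :: comm_monoid_add"
  shows "(\<Sum>t = 0..<b * d. g (t div d) (t mod d)) = (\<Sum>s = 0..<b. \<Sum>u = 0..<d. g s u)"
proof -
  have "(\<Sum>t = 0..<b * d. g (t div d) (t mod d)) =
    (\<Sum>s = 0..<b. \<Sum>t = s * d..<s * d + d. g (t div d) (t mod d))"
    by (simp add: atLeast0LessThan sum.nat_group)
  also have "\<dots> = (\<Sum>s = 0..<b. \<Sum>u = 0..<d. g s u)"
  proof (rule sum.cong[OF refl])
    fix s
    have "(\<Sum>t = s * d..<s * d + d. g (t div d) (t mod d)) =
      (\<Sum>u = 0..<d. g ((s * d + u) div d) ((s * d + u) mod d))"
      using sum.atLeastLessThan_shift_0[of "\<lambda>t. g (t div d) (t mod d)" "s * d" "s * d + d"] by simp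
    also have "\<dots> = (\<Sum>u = 0..<d. g s u)"
      by (intro sum.cong) auto
    finally show "(\<Sum>t = s * d..<s * d + d. g (t div d) (t mod d)) = (\<Sum>u = 0..<d. g s u)" .
  qed
  finally show ?thesis .
qed

text \<open>The mixed-product rule: the inner index \<open>t\<close> splits into
  \<open>t div mb\<close> and \<open>t mod mb\<close>, and the resulting double sum factors into the
  two inner products.\<close>

lemma kronecker_mult:
  fixes A B C D :: "'a :: comm_semiring_1 mat"
  assumes A: "A \<in> carrier_mat na nb" and C: "C \<in> carrier_mat nb nc"
    and B: "B \<in> carrier_mat ma mb" and D: "D \<in> carrier_mat mb mc"
  shows "(A * C) \<otimes>\<^sub>K (B * D) = (A \<otimes>\<^sub>K B) * (C \<otimes>\<^sub>K D)"
proof (rule eq_matI)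
  fix i j assume "i < dim_row ((A \<otimes>\<^sub>K B) * (C \<otimes>\<^sub>K D))" "j < dim_col ((A \<otimes>\<^sub>K B) * (C \<otimes>\<^sub>K D))"
  then have ij: "i < na * ma" "j < nc * mc" using assms by (auto simp: kronecker_def)
  then have pos: "ma > 0" "mc > 0" by (auto intro: Nat.gr0I)
  have dm: "i div ma < na" "i mod ma < ma" "j div mc < nc" "j mod mc < mc"
    using ij pos by (auto simp: less_mult_imp_div_less)
  have "((A \<otimes>\<^sub>K B) * (C \<otimes>\<^sub>K D)) $$ (i, j) =
    (\<Sum>t = 0..<nb * mb. (A $$ (i div ma, t div mb) * B $$ (i mod ma, t mod mb)) *
       (C $$ (t div mb, j div mc) * D $$ (t mod mb, j mod mc)))"
    using assms ij by (auto simp: kronecker_def scalar_prod_def intro!: sum.cong)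
  also have "\<dots> = (\<Sum>s = 0..<nb. \<Sum>u = 0..<mb. (A $$ (i div ma, s) * B $$ (i mod ma, u)) *
       (C $$ (s, j div mc) * D $$ (u, j mod mc)))"
    by (rule sum_div_mod)
  also have "\<dots> = (A * C) $$ (i div ma, j div mc) * (B * D) $$ (i mod ma, j mod mc)"
    using assms dm by (simp add: scalar_prod_def sum_product mult_ac)
  also have "\<dots> = ((A * C) \<otimes>\<^sub>K (B * D)) $$ (i, j)"
    using assms ij by (auto simp: kronecker_def)
  finally show "((A * C) \<otimes>\<^sub>K (B * D)) $$ (i, j) = ((A \<otimes>\<^sub>K B) * (C \<otimes>\<^sub>K D)) $$ (i, j)" by simp
qed (use assms in \<open>auto simp: kronecker_def\<close>)

lemma kronecker_list_map_carrier:
  "(\<And>a. a \<in> set xs \<Longrightarrow> F a \<in> carrier_mat n n) \<Longrightarrow>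
   kronecker_list (map F xs) \<in> carrier_mat (n ^ length xs) (n ^ length xs)"
  using kronecker_list_carrier[of "map F xs" n] by auto

lemma kronecker_list_mult:
  fixes F G :: "'b \<Rightarrow> 'a :: comm_semiring_1 mat"
  assumes "\<And>a. a \<in> set xs \<Longrightarrow> F a \<in> carrier_mat n n" "\<And>a. a \<in> set xs \<Longrightarrow> G a \<in> carrier_mat n n"
  shows "kronecker_list (map (\<lambda>a. F a * G a) xs) = kronecker_list (map F xs) * kronecker_list (map G xs)"
  using assms
proof (induction xs)
  case Nil
  then show ?case by (simp add: kronecker_list_def)
next
  case (Cons a xs)
  have K: "kronecker_list (map F xs) \<in> carrier_mat (n ^ length xs) (n ^ length xs)"
    "kronecker_list (map G xs) \<in> carrier_mat (n ^ length xs) (n ^ length xs)"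
    by (intro kronecker_list_map_carrier; use Cons.prems in simp)+
  have "kronecker_list (map (\<lambda>a. F a * G a) (a # xs)) =
    (F a * G a) \<otimes>\<^sub>K (kronecker_list (map F xs) * kronecker_list (map G xs))"
    using Cons by (simp add: kronecker_list_def)
  also have "\<dots> = (F a \<otimes>\<^sub>K kronecker_list (map F xs)) * (G a \<otimes>\<^sub>K kronecker_list (map G xs))"
    using Cons.prems K by (intro kronecker_mult) auto
  finally show ?case by (simp add: kronecker_list_def)
qed

lemma kronecker_one: "1\<^sub>m a \<otimes>\<^sub>K 1\<^sub>m b = (1\<^sub>m (a * b) :: 'a :: comm_semiring_1 mat)"
proof (rule eq_matI)
  fix i j assume "i < dim_row (1\<^sub>m (a * b) :: 'a mat)" "j < dim_col (1\<^sub>m (a * b) :: 'a mat)"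
  then have ij: "i < a * b" "j < a * b" by auto
  then have "b > 0" by (auto intro: Nat.gr0I)
  moreover have "i = j \<longleftrightarrow> i div b = j div b \<and> i mod b = j mod b"
    by (metis div_mult_mod_eq)
  ultimately show "(1\<^sub>m a \<otimes>\<^sub>K 1\<^sub>m b) $$ (i, j) = (1\<^sub>m (a * b) :: 'a mat) $$ (i, j)"
    using ij by (auto simp: kronecker_def less_mult_imp_div_less)
qed (auto simp: kronecker_def)

lemma kronecker_list_one:
  "kronecker_list (map (\<lambda>_. 1\<^sub>m n) xs) = (1\<^sub>m (n ^ length xs) :: 'a :: comm_semiring_1 mat)"
  by (induction xs) (auto simp: kronecker_list_def kronecker_one)

lemma det_nonzero_inverse:
  fixes A :: "'a :: field mat"
  assumes "A \<in> carrier_mat n n" "det A \<noteq> 0"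
  shows "\<exists>B \<in> carrier_mat n n. A * B = 1\<^sub>m n \<and> B * A = 1\<^sub>m n"
  using det_non_zero_imp_unit[OF assms, of undefined] by (auto simp: Units_def ring_mat_def)

lemma det_nonzero_invertible_mat:
  fixes A :: "'a :: field mat"
  assumes "A \<in> carrier_mat n n" "det A \<noteq> 0"
  shows "invertible_mat A"
  using det_nonzero_inverse[OF assms] assms(1)
  unfolding invertible_mat_def inverts_mat_def by auto

text \<open>Inverting factor by factor inverts the Kronecker product, by the mixed-product rule, so
  its determinant divides 1.\<close>

lemma det_kronecker_list_nonzero:
  fixes F :: "'b \<Rightarrow> 'a :: field mat"
  assumes F: "\<And>a. a \<in> set xs \<Longrightarrow> F a \<in> carrier_mat n n" "\<And>a. a \<in> set xs \<Longrightarrow> det (F a) \<noteq> 0"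
  shows "det (kronecker_list (map F xs)) \<noteq> 0"
proof -
  have "\<forall>a \<in> set xs. \<exists>B. B \<in> carrier_mat n n \<and> F a * B = 1\<^sub>m n"
    using det_nonzero_inverse F by blast
  then obtain G where G: "\<And>a. a \<in> set xs \<Longrightarrow> G a \<in> carrier_mat n n"
    "\<And>a. a \<in> set xs \<Longrightarrow> F a * G a = 1\<^sub>m n"
    by (metis (no_types, lifting))
  have "kronecker_list (map F xs) * kronecker_list (map G xs) = kronecker_list (map (\<lambda>a. F a * G a) xs)"
    using F(1) G(1) by (intro kronecker_list_mult[symmetric])
  also have "map (\<lambda>a. F a * G a) xs = map (\<lambda>_. 1\<^sub>m n) xs" using G(2) by simp
  also have "kronecker_list \<dots> = 1\<^sub>m (n ^ length xs)" by (rule kronecker_list_one)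
  finally have "det (kronecker_list (map F xs)) * det (kronecker_list (map G xs)) = 1"
    using kronecker_list_map_carrier[of xs F n] kronecker_list_map_carrier[of xs G n] F(1) G(1)
    by (metis det_mult det_one)
  then show ?thesis by auto
qed

text \<open>Nonzero entries chosen in the factors supply the digits of a row and a column index; the
  entry there is their product. This will provide a nonzero column of a Kronecker power.\<close>

lemma kronecker_list_nonzero_entry:
  fixes As :: "'a :: {comm_semiring_1, semiring_no_zero_divisors} mat list"
  assumes "\<And>A. A \<in> set As \<Longrightarrow> A \<in> carrier_mat n n \<and> (\<exists>i<n. \<exists>j<n. A $$ (i, j) \<noteq> 0)"
  shows "\<exists>i<n ^ length As. \<exists>j<n ^ length As. kronecker_list As $$ (i, j) \<noteq> 0"
  using assms
proof (induction As)
  case Nil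
  then show ?case by (simp add: kronecker_list_def)
next
  case (Cons A As)
  let ?m = "n ^ length As"
  from Cons obtain i j i' j' where ij: "i < n" "j < n" "A $$ (i, j) \<noteq> 0"
    "i' < ?m" "j' < ?m" "kronecker_list As $$ (i', j') \<noteq> 0"
    by (metis list.set_intros)
  have K: "kronecker_list As \<in> carrier_mat ?m ?m"
    using Cons.prems by (intro kronecker_list_carrier) auto
  have A: "A \<in> carrier_mat n n" using Cons.prems by simp
  have less: "u * ?m + u' < n * ?m" if "u < n" "u' < ?m" for u u'
  proof -
    have "u * ?m + u' < Suc u * ?m" using that by simp
    also have "\<dots> \<le> n * ?m" using that by (intro mult_le_mono1) simp
    finally show ?thesis .
  qed
  have "kronecker_list (A # As) $$ (i * ?m + i', j * ?m + j') = A $$ (i, j) * kronecker_list As $$ (i', j')"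
    using carrier_matD[OF A] carrier_matD[OF K] ij less by (simp add: kronecker_list_def kronecker_def)
  then show ?case
    using ij less[of i i'] less[of j j'] by (metis length_Cons mult_eq_0_iff power_Suc)
qed

section \<open>Entries of the operator determinant\<close>

lemma
  assumes "\<And>a b. a < k \<Longrightarrow> b < k \<Longrightarrow> A a b \<in> carrier_mat n n"
  shows operator_det_carrier: "operator_det k n A \<in> carrier_mat (n ^ k) (n ^ k)"
    and operator_det_eq_sum: "I < n ^ k \<Longrightarrow> J < n ^ k \<Longrightarrow> operator_det k n A $$ (I, J) =
      (\<Sum>\<sigma> | \<sigma> permutes {..<k}. of_int (sign \<sigma>) * kronecker_list (map (\<lambda>a. A a (\<sigma> a)) [0..<k]) $$ (I, J))"
proof -
  \<comment> \<open>\<open>finsum_mat\<close> is meaningful only for summands in the carrier; a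
    permutation of \<open>{..<k}\<close> keeps \<open>\<sigma> a\<close> below \<open>k\<close>,
    where the hypothesis on \<open>A\<close> applies.\<close>
  have K: "kronecker_list (map (\<lambda>a. A a (\<sigma> a)) [0..<k]) \<in> carrier_mat (n ^ k) (n ^ k)"
    if "\<sigma> permutes {..<k}" for \<sigma>
    using kronecker_list_map_carrier[of "[0..<k]" "\<lambda>a. A a (\<sigma> a)" n] assms permutes_in_image[OF that]
    by auto
  show "operator_det k n A \<in> carrier_mat (n ^ k) (n ^ k)"
    unfolding operator_det_def using K
    by (intro finsum_mat_carrier_index[THEN conjunct1]) (auto simp: finite_permutations)
  show "operator_det k n A $$ (I, J) =
      (\<Sum>\<sigma> | \<sigma> permutes {..<k}. of_int (sign \<sigma>) * kronecker_list (map (\<lambda>a. A a (\<sigma> a)) [0..<k]) $$ (I, J))"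
    if "I < n ^ k" "J < n ^ k"
  proof -
    have "operator_det k n A $$ (I, J) =
      (\<Sum>\<sigma> | \<sigma> permutes {..<k}. (of_int (sign \<sigma>) \<cdot>\<^sub>m kronecker_list (map (\<lambda>a. A a (\<sigma> a)) [0..<k])) $$ (I, J))"
      unfolding operator_det_def using K that
      by (intro finsum_mat_carrier_index[THEN conjunct2, rule_format]) (auto simp: finite_permutations)
    also have "\<dots> = (\<Sum>\<sigma> | \<sigma> permutes {..<k}.
        of_int (sign \<sigma>) * kronecker_list (map (\<lambda>a. A a (\<sigma> a)) [0..<k]) $$ (I, J))"
      using K[THEN carrier_matD(1)] K[THEN carrier_matD(2)] that
      by (intro sum.cong refl index_smult_mat(1)) auto
    finally show ?thesis .
  qed
qed

text \<open>The Leibniz formula read backwards: by \<open>kronecker_list_index\<close> each summand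
  is a signed product with one factor per row \<open>a\<close>, and the position inside the blocks
  of row \<open>a\<close> depends on \<open>I\<close>, \<open>J\<close> and \<open>a\<close> but not
  on the permutation.\<close>

lemma operator_det_index:
  assumes "n > 0" and A: "\<And>a b. a < k \<Longrightarrow> b < k \<Longrightarrow> A a b \<in> carrier_mat n n"
    and IJ: "I < n ^ k" "J < n ^ k"
  shows "operator_det k n A $$ (I, J) =
    det (mat k k (\<lambda>(a, b). A a b $$ (digit n k a I, digit n k a J)))"
proof -
  have "kronecker_list (map (\<lambda>a. A a (\<sigma> a)) [0..<k]) $$ (I, J) =
      (\<Prod>a<k. A a (\<sigma> a) $$ (digit n k a I, digit n k a J))" if "\<sigma> permutes {..<k}" for \<sigma>
  proof -
    have "set (map (\<lambda>a. A a (\<sigma> a)) [0..<k]) \<subseteq> carrier_mat n n"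
      using A permutes_in_image[OF that] by auto
    then show ?thesis
      using kronecker_list_index[of n "map (\<lambda>a. A a (\<sigma> a)) [0..<k]" I J] \<open>n > 0\<close> IJ by auto
  qed
  then have "operator_det k n A $$ (I, J) =
    (\<Sum>\<sigma> | \<sigma> permutes {..<k}. of_int (sign \<sigma>) * (\<Prod>a<k. A a (\<sigma> a) $$ (digit n k a I, digit n k a J)))"
    using A IJ by (simp add: operator_det_eq_sum)
  also have "\<dots> = det (mat k k (\<lambda>(a, b). A a b $$ (digit n k a I, digit n k a J)))"
  proof -
    have "(\<Prod>a<k. A a (\<sigma> a) $$ (digit n k a I, digit n k a J)) =
      (\<Prod>a<k. mat k k (\<lambda>(a, b). A a b $$ (digit n k a I, digit n k a J)) $$ (a, \<sigma> a))"
      if "\<sigma> permutes {..<k}" for \<sigma>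
      using permutes_in_image[OF that] by (intro prod.cong) auto
    then show ?thesis
      by (simp add: det_def'[of _ k] atLeast0LessThan)
  qed
  finally show ?thesis .
qed

text \<open>Arrays given by list access or by coordinates agree only for indices below
  \<open>k\<close>, so equality of functions is too much to ask.\<close>

lemma operator_det_cong:
  assumes A: "\<And>a b. a < k \<Longrightarrow> b < k \<Longrightarrow> A a b \<in> carrier_mat n n"
    and eq: "\<And>a b. a < k \<Longrightarrow> b < k \<Longrightarrow> A a b = B a b"
  shows "operator_det k n A = operator_det k n B"
proof -
  have B: "B a b \<in> carrier_mat n n" if "a < k" "b < k" for a b
    using A[OF that] eq[OF that] by simp
  have K: "kronecker_list (map (\<lambda>a. A a (\<sigma> a)) [0..<k]) = kronecker_list (map (\<lambda>a. B a (\<sigma> a)) [0..<k])"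
    if "\<sigma> permutes {..<k}" for \<sigma>
    using eq permutes_in_image[OF that] by (intro arg_cong[of _ _ kronecker_list]) auto
  have carrier: "operator_det k n A \<in> carrier_mat (n ^ k) (n ^ k)"
    "operator_det k n B \<in> carrier_mat (n ^ k) (n ^ k)"
    using A B by (auto intro!: operator_det_carrier)
  show ?thesis
  proof (rule eq_matI)
    fix I J assume "I < dim_row (operator_det k n B)" "J < dim_col (operator_det k n B)"
    then have "I < n ^ k" "J < n ^ k" using carrier by auto
    then show "operator_det k n A $$ (I, J) = operator_det k n B $$ (I, J)"
      using A B K by (simp add: operator_det_eq_sum)
  qed (use carrier in auto)
qed

text \<open>\<open>C a\<close> depends on the block row only. By the mixed-product rule every
  permutation therefore yields the same right factor, which comes out of the signed sum.\<close>

lemma operator_det_mult_right: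
  assumes A: "\<And>a b. a < k \<Longrightarrow> b < k \<Longrightarrow> A a b \<in> carrier_mat n n"
    and C: "\<And>a. a < k \<Longrightarrow> C a \<in> carrier_mat n n"
  shows "operator_det k n (\<lambda>a b. A a b * C a) = operator_det k n A * kronecker_list (map C [0..<k])"
proof (rule eq_matI)
  let ?K = "\<lambda>\<sigma>. kronecker_list (map (\<lambda>a. A a (\<sigma> a)) [0..<k])"
  let ?C = "kronecker_list (map C [0..<k])"
  have AC: "A a b * C a \<in> carrier_mat n n" if "a < k" "b < k" for a b
    using that A C by (blast intro: mult_carrier_mat)
  have CC: "?C \<in> carrier_mat (n ^ k) (n ^ k)"
    using kronecker_list_map_carrier[of "[0..<k]" C n] C by auto
  have D: "operator_det k n A \<in> carrier_mat (n ^ k) (n ^ k)"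
    using A by (rule operator_det_carrier)
  have D': "operator_det k n (\<lambda>a b. A a b * C a) \<in> carrier_mat (n ^ k) (n ^ k)"
    using AC by (rule operator_det_carrier)
  show "dim_row (operator_det k n (\<lambda>a b. A a b * C a)) = dim_row (operator_det k n A * ?C)"
    "dim_col (operator_det k n (\<lambda>a b. A a b * C a)) = dim_col (operator_det k n A * ?C)"
    using D D' CC by auto
  fix I J assume "I < dim_row (operator_det k n A * ?C)" "J < dim_col (operator_det k n A * ?C)"
  then have IJ: "I < n ^ k" "J < n ^ k" using D CC by auto
  have "operator_det k n (\<lambda>a b. A a b * C a) $$ (I, J) =
      (\<Sum>\<sigma> | \<sigma> permutes {..<k}. of_int (sign \<sigma>) * (?K \<sigma> * ?C) $$ (I, J))"
    unfolding operator_det_eq_sum[of k "\<lambda>a b. A a b * C a" n, OF AC IJ, simplified]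
  proof (intro sum.cong refl arg_cong2[of _ _ _ _ "(*)"])
    fix \<sigma> assume "\<sigma> \<in> {\<sigma>. \<sigma> permutes {..<k}}"
    then show "kronecker_list (map (\<lambda>a. A a (\<sigma> a) * C a) [0..<k]) $$ (I, J) = (?K \<sigma> * ?C) $$ (I, J)"
      using A C permutes_in_image[of \<sigma> "{..<k}"] by (subst kronecker_list_mult[of _ _ n]) auto
  qed
  also have "\<dots> = (\<Sum>\<sigma> | \<sigma> permutes {..<k}. \<Sum>L = 0..<n ^ k. of_int (sign \<sigma>) * ?K \<sigma> $$ (I, L) * ?C $$ (L, J))"
  proof (intro sum.cong refl)
    fix \<sigma> assume "\<sigma> \<in> {\<sigma>. \<sigma> permutes {..<k}}"
    then have "?K \<sigma> \<in> carrier_mat (n ^ k) (n ^ k)"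
      using A permutes_in_image[of \<sigma> "{..<k}"]
        kronecker_list_map_carrier[of "[0..<k]" "\<lambda>a. A a (\<sigma> a)" n] by auto
    then show "of_int (sign \<sigma>) * (?K \<sigma> * ?C) $$ (I, J) =
        (\<Sum>L = 0..<n ^ k. of_int (sign \<sigma>) * ?K \<sigma> $$ (I, L) * ?C $$ (L, J))"
      using CC IJ by (simp add: scalar_prod_def sum_distrib_left mult.assoc)
  qed
  also have "\<dots> = (\<Sum>L = 0..<n ^ k. operator_det k n A $$ (I, L) * ?C $$ (L, J))"
    using IJ A by (subst sum.swap) (simp add: operator_det_eq_sum sum_distrib_right)
  also have "\<dots> = (operator_det k n A * ?C) $$ (I, J)"
    using CC D IJ by (simp add: scalar_prod_def)
  finally show "operator_det k n (\<lambda>a b. A a b * C a) $$ (I, J) = (operator_det k n A * ?C) $$ (I, J)" .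
qed

section \<open>Singularity from a linear relation\<close>

lemma det_operator_det_zero:
  fixes A :: "nat \<Rightarrow> nat \<Rightarrow> 'a :: field mat"
  assumes "n > 0" and A: "\<And>a b. a < k \<Longrightarrow> b < k \<Longrightarrow> A a b \<in> carrier_mat n n"
    and x: "x \<in> carrier_vec n" "x \<noteq> 0\<^sub>v n"
    and l: "l \<in> carrier_vec k" "l \<noteq> 0\<^sub>v k"
    and dep: "\<And>a r. a < k \<Longrightarrow> r < n \<Longrightarrow> (\<Sum>b<k. (A a b *\<^sub>v x) $ r * l $ b) = 0"
  shows "det (operator_det k n A) = 0"
proof -
  \<comment> \<open>All columns of \<open>X\<close> equal \<open>x\<close>, so every column of its
    Kronecker power is the tensor power of \<open>x\<close>. Being square, \<open>X\<close> fits
    \<open>operator_det_mult_right\<close>.\<close>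
  define X where "X = mat n n (\<lambda>(i, j). x $ i)"
  have X: "X \<in> carrier_mat n n" by (simp add: X_def)
  let ?D = "operator_det k n A" and ?K = "kronecker_list (map (\<lambda>_. X) [0..<k])"
  have D: "?D \<in> carrier_mat (n ^ k) (n ^ k)" using A by (rule operator_det_carrier)
  have K: "?K \<in> carrier_mat (n ^ k) (n ^ k)"
    using kronecker_list_map_carrier[of "[0..<k]" "\<lambda>_. X" n] X by simp
  have zero: "(?D * ?K) $$ (I, J) = 0" if IJ: "I < n ^ k" "J < n ^ k" for I J
  proof -
    let ?M = "mat k k (\<lambda>(a, b). (A a b * X) $$ (digit n k a I, digit n k a J))"
    have "?D * ?K = operator_det k n (\<lambda>a b. A a b * X)"
      using A X by (intro operator_det_mult_right[symmetric])
    also have "\<dots> $$ (I, J) = det ?M"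
      using A X IJ \<open>n > 0\<close> by (intro operator_det_index) (auto intro: mult_carrier_mat)
    \<comment> \<open>The column digit drops out because the columns of \<open>X\<close>
      coincide.\<close>
    also have "?M = mat k k (\<lambda>(a, b). (A a b *\<^sub>v x) $ digit n k a I)"
    proof (rule eq_matI; clarsimp)
      fix a b assume ab: "a < k" "b < k"
      have "(A a b * X) $$ (r, s) = (A a b *\<^sub>v x) $ r" if "r < n" "s < n" for r s
        using A[OF ab] x that by (simp add: X_def scalar_prod_def)
      then show "(A a b * X) $$ (digit n k a I, digit n k a J) = (A a b *\<^sub>v x) $ digit n k a I"
        by (simp add: digit_less \<open>n > 0\<close>)
    qed
    also have "det (mat k k (\<lambda>(a, b). (A a b *\<^sub>v x) $ digit n k a I)) = 0" (is "det ?N = 0")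
    proof -
      \<comment> \<open>For fixed \<open>I\<close> the position in the vectors depends only on the
        row \<open>a\<close>, so \<open>dep\<close> says that \<open>l\<close> annihilates each
        row.\<close>
      have "?N *\<^sub>v l = 0\<^sub>v k"
        using l dep digit_less[OF \<open>n > 0\<close>]
        by (intro eq_vecI) (auto simp: scalar_prod_def atLeast0LessThan)
      then show ?thesis using l by (subst det_0_iff_vec_prod_zero[of _ k]) auto
    qed
    finally show ?thesis .
  qed
  \<comment> \<open>By \<open>zero\<close>, the operator determinant kills every column of
    \<open>?K\<close>; it remains to find a nonzero one.\<close>
  obtain i where "i < n" "x $ i \<noteq> 0" using x by (metis carrier_vecD eq_vecI index_zero_vec)
  then have "X $$ (i, i) \<noteq> 0" by (simp add: X_def)
  then obtain I J where IJ: "I < n ^ k" "J < n ^ k" "?K $$ (I, J) \<noteq> 0"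
    using kronecker_list_nonzero_entry[of "map (\<lambda>_. X) [0..<k]" n] X \<open>i < n\<close> by fastforce
  let ?v = "col ?K J"
  have "?v \<noteq> 0\<^sub>v (n ^ k)"
    using IJ K by (metis carrier_matD index_col index_zero_vec(1))
  moreover have "?D *\<^sub>v ?v = 0\<^sub>v (n ^ k)"
  proof (rule eq_vecI)
    fix I' assume "I' < dim_vec (0\<^sub>v (n ^ k) :: 'a vec)"
    then show "(?D *\<^sub>v ?v) $ I' = 0\<^sub>v (n ^ k) $ I'"
      using zero[of I' J] D K IJ(2) by simp
  qed (use D in simp)
  ultimately show ?thesis
    using col_carrier_vec[OF IJ(2) K] by (subst det_0_iff_vec_prod_zero[OF D]) blast
qed

section \<open>Vandermonde determinants\<close>

lemma det_vandermonde_nonzero: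
  fixes t :: "nat \<Rightarrow> 'a :: field"
  assumes inj: "inj_on t {..<k}"
  shows "det (mat k k (\<lambda>(a, b). t a ^ b)) \<noteq> 0"
proof
  assume "det (mat k k (\<lambda>(a, b). t a ^ b)) = 0"
  then obtain v where v: "v \<in> carrier_vec k" "v \<noteq> 0\<^sub>v k" "mat k k (\<lambda>(a, b). t a ^ b) *\<^sub>v v = 0\<^sub>v k"
    by (subst (asm) det_0_iff_vec_prod_zero[of _ k]) auto
  \<comment> \<open>A kernel vector is the coefficient list of a nonzero polynomial of degree below
    \<open>k\<close> that vanishes at \<open>k\<close> distinct nodes.\<close>
  define p where "p = (\<Sum>b<k. monom (v $ b) b)"
  have root: "poly p (t a) = 0" if "a < k" for a
  proof -
    have "(mat k k (\<lambda>(a, b). t a ^ b) *\<^sub>v v) $ a = (\<Sum>b<k. t a ^ b * v $ b)"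
      using that v(1) by (simp add: scalar_prod_def atLeast0LessThan)
    moreover have "(mat k k (\<lambda>(a, b). t a ^ b) *\<^sub>v v) $ a = 0"
      unfolding v(3) using that by simp
    ultimately show ?thesis
      by (simp add: p_def poly_sum poly_monom mult.commute)
  qed
  have coeff: "coeff p b = (if b < k then v $ b else 0)" for b
    by (simp add: p_def coeff_sum coeff_monom)
  obtain b where "b < k" "v $ b \<noteq> 0" using v by (metis carrier_vecD eq_vecI index_zero_vec)
  then have "p \<noteq> 0" using coeff[of b] by auto
  have "degree p < k"
    using \<open>b < k\<close> coeff by (intro degree_lessI) auto
  moreover have "k \<le> card {x. poly p x = 0}"
  proof -
    have "card (t ` {..<k}) \<le> card {x. poly p x = 0}"
      using root poly_roots_finite[OF \<open>p \<noteq> 0\<close>] by (intro card_mono) auto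
    then show ?thesis by (simp add: card_image inj)
  qed
  ultimately show False
    using card_poly_roots_bound[OF \<open>p \<noteq> 0\<close>] by simp
qed

text \<open>Each Leibniz term takes exactly one entry from every row and so carries each
  \<open>u a\<close> once.\<close>

lemma det_scale_rows:
  "det (mat k k (\<lambda>(a, b). u a * M a b)) = (\<Prod>a<k. u a) * det (mat k k (\<lambda>(a, b). M a b))"
proof -
  have "(\<Prod>a = 0..<k. mat k k (\<lambda>(a, b). u a * M a b) $$ (a, \<sigma> a)) =
    (\<Prod>a<k. u a) * (\<Prod>a = 0..<k. mat k k (\<lambda>(a, b). M a b) $$ (a, \<sigma> a))" if "\<sigma> permutes {0..<k}" for \<sigma>
    unfolding atLeast0LessThan prod.distrib[symmetric]
    using permutes_in_image[OF that] by (intro prod.cong) auto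
  then have "det (mat k k (\<lambda>(a, b). u a * M a b)) = (\<Sum>\<sigma> | \<sigma> permutes {0..<k}. of_int (sign \<sigma>) *
      ((\<Prod>a<k. u a) * (\<Prod>a = 0..<k. mat k k (\<lambda>(a, b). M a b) $$ (a, \<sigma> a))))"
    by (subst det_def'[of _ k]) auto
  also have "\<dots> = (\<Prod>a<k. u a) * det (mat k k (\<lambda>(a, b). M a b))"
    by (subst det_def'[of _ k], simp, subst sum_distrib_left) (simp only: mult.left_commute)
  finally show ?thesis .
qed

lemma det_operator_det_vandermonde_nonzero:
  fixes t :: "nat \<Rightarrow> nat \<Rightarrow> 'a :: field"
  assumes "n > 0" and inj: "inj_on (case_prod t) ({..<k} \<times> {..<n})"
  shows "det (operator_det k n (\<lambda>a b. mat n n (\<lambda>(r, s). t a r ^ (s + b)))) \<noteq> 0"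
proof -
  let ?D = "operator_det k n (\<lambda>a b. mat n n (\<lambda>(r, s). t a r ^ (s + b)))"
  define V where "V a = mat n n (\<lambda>(r, s). t a r ^ s)" for a
  \<comment> \<open>What is left after extracting the row factors: a Vandermonde determinant with
    one node from each block row, selected by the digits of \<open>I\<close>.\<close>
  define d where "d I = det (mat k k (\<lambda>(a, b). t a (digit n k a I) ^ b))" for I
  let ?K = "kronecker_list (map V [0..<k])"
  have K: "?K \<in> carrier_mat (n ^ k) (n ^ k)"
    using kronecker_list_map_carrier[of "[0..<k]" V n] by (simp add: V_def)
  have D: "?D \<in> carrier_mat (n ^ k) (n ^ k)" by (rule operator_det_carrier) simp
  have "?D $$ (I, J) = d I * ?K $$ (I, J)" if IJ: "I < n ^ k" "J < n ^ k" for I J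
  proof -
    have "?D $$ (I, J) = det (mat k k (\<lambda>(a, b). t a (digit n k a I) ^ digit n k a J * t a (digit n k a I) ^ b))"
      using \<open>n > 0\<close> IJ by (subst operator_det_index) (simp_all add: digit_less power_add)
    also have "\<dots> = (\<Prod>a<k. t a (digit n k a I) ^ digit n k a J) * d I"
      unfolding d_def by (rule det_scale_rows)
    also have "(\<Prod>a<k. t a (digit n k a I) ^ digit n k a J) = ?K $$ (I, J)"
    proof -
      have "set (map V [0..<k]) \<subseteq> carrier_mat n n" by (auto simp: V_def)
      then show ?thesis
        using kronecker_list_index[of n "map V [0..<k]" I J] \<open>n > 0\<close> IJ
        by (simp add: V_def digit_less)
    qed
    finally show ?thesis by simp
  qed
  then have "?D = mat_diag (n ^ k) d * ?K"
    using D by (intro eq_matI) (auto simp: mat_diag_mult_left[OF K])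
  then have "det ?D = (\<Prod>I = 0..<n ^ k. d I) * det ?K"
    using K by (simp add: det_mult[of _ "n ^ k"])
      (simp add: mat_diag_def det_upper_triangular[of _ "n ^ k"] prod_list_diag_prod upper_triangular_def)
  \<comment> \<open>\<open>d I\<close> needs nodes of different block rows to be distinct,
    \<open>V a\<close> nodes of the same one; injectivity on pairs gives both.\<close>
  moreover have "d I \<noteq> 0" for I
    unfolding d_def using inj digit_less[OF \<open>n > 0\<close>]
    by (intro det_vandermonde_nonzero) (fastforce simp: inj_on_def)
  moreover have "det ?K \<noteq> 0"
  proof (rule det_kronecker_list_nonzero[where n = n])
    fix a assume "a \<in> set [0..<k]"
    then show "det (V a) \<noteq> 0"
      unfolding V_def using inj by (intro det_vandermonde_nonzero) (auto simp: inj_on_def)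
  qed (simp add: V_def)
  ultimately show ?thesis by simp
qed

section \<open>Generic tuples of matrices\<close>

text \<open>\<open>lin_indpt_full_rank\<close> speaks of the set of columns and so also wants them
  distinct. Two equal columns would put a difference of unit vectors into the kernel.\<close>

lemma rank_eq_dim_col:
  fixes A :: "'a :: field mat"
  assumes A: "A \<in> carrier_mat n nc"
    and ker: "\<And>v. v \<in> carrier_vec nc \<Longrightarrow> A *\<^sub>v v = 0\<^sub>v n \<Longrightarrow> v = 0\<^sub>v nc"
  shows "vec_space.rank n A = nc"
proof -
  interpret vec_space "TYPE('a)" n .
  have unit: "A *\<^sub>v unit_vec nc i = col A i" if "i < nc" for i
    using A that by (intro eq_vecI) auto
  have "distinct (cols A)"
    unfolding distinct_conv_nth
  proof (intro allI impI)
    fix i j assume "i < length (cols A)" "j < length (cols A)" and "i \<noteq> j"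
    then have ij: "i < nc" "j < nc" using A by auto
    have "A *\<^sub>v (unit_vec nc i - unit_vec nc j) = A *\<^sub>v unit_vec nc i - A *\<^sub>v unit_vec nc j"
      using A by (intro mult_minus_distrib_mat_vec) auto
    also have "\<dots> = col A i - col A j"
      using unit ij by simp
    finally have eq: "A *\<^sub>v (unit_vec nc i - unit_vec nc j) = col A i - col A j" .
    show "cols A ! i \<noteq> cols A ! j"
    proof
      assume "cols A ! i = cols A ! j"
      then have "col A i - col A j = 0\<^sub>v n" using A ij by auto
      then have "unit_vec nc i - unit_vec nc j = (0\<^sub>v nc :: 'a vec)"
        using ker[of "unit_vec nc i - unit_vec nc j"] eq by simp
      then have "(unit_vec nc i - unit_vec nc j) $ i = (0 :: 'a)" using ij by simp
      then show False using ij \<open>i \<noteq> j\<close> by simp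
    qed
  qed
  moreover have "lin_indpt (set (cols A))"
    using lin_depE[OF A _ \<open>distinct (cols A)\<close>] ker by metis
  ultimately show ?thesis using A by (intro lin_indpt_full_rank)
qed

text \<open>Recovers the matrix number \<open>a\<close> from a flattened tuple. Its dimensions are
  right for every \<open>x\<close>, as the rules on polynomial determinants demand.\<close>

definition mat_of_coords :: "nat \<Rightarrow> nat \<Rightarrow> nat \<Rightarrow> 'a vec \<Rightarrow> 'a mat" where
  "mat_of_coords nr nc a x = mat nr nc (\<lambda>(i, j). x $ (a * (nr * nc) + (i * nc + j)))"

lemma mat_tuples_nth: "Ms \<in> mat_tuples k nr nc \<Longrightarrow> a < k \<Longrightarrow> Ms ! a \<in> carrier_mat nr nc"
  by (auto simp: mat_tuples_def)

lemma mat_of_coords_carrier: "mat_of_coords nr nc a x \<in> carrier_mat nr nc"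
  by (simp add: mat_of_coords_def)

lemma mat_of_coords_vec_of_mats:
  assumes "Ms \<in> mat_tuples k nr nc" "a < k"
  shows "mat_of_coords nr nc a (vec_of_mats k nr nc Ms) = Ms ! a"
proof -
  show ?thesis
    using assms(2) mat_tuples_nth[OF assms] by (intro eq_matI) (auto simp: mat_of_coords_def vec_of_mats_nth(2))
qed

lemma polynomial_on_mat_of_coords:
  assumes "a < k" "i < nr" "j < nc"
  shows "polynomial_on (k * (nr * nc)) (\<lambda>x. mat_of_coords nr nc a x $$ (i, j))"
  using polynomial_on_coord[OF vec_of_mats_nth(1)[OF assms]] assms by (simp add: mat_of_coords_def)

lemma polynomial_on_mat_mult:
  assumes "\<And>x. A x \<in> carrier_mat p q" "\<And>x. B x \<in> carrier_mat q s"
    and "\<And>i j. i < p \<Longrightarrow> j < q \<Longrightarrow> polynomial_on r (\<lambda>x. A x $$ (i, j))"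
    and "\<And>i j. i < q \<Longrightarrow> j < s \<Longrightarrow> polynomial_on r (\<lambda>x. B x $$ (i, j))"
    and "i < p" "j < s"
  shows "polynomial_on r (\<lambda>x. (A x * B x) $$ (i, j))"
proof -
  have "(A x * B x) $$ (i, j) = (\<Sum>c = 0..<q. A x $$ (i, c) * B x $$ (c, j))" for x
    using assms(1,2)[of x] assms(5,6) by (simp add: scalar_prod_def)
  then show ?thesis
    using assms by (auto intro!: polynomial_on_sum polynomial_on_mult)
qed

text \<open>By \<open>operator_det_index\<close> the entries are themselves determinants, so the
  determinant rule is applied at two levels.\<close>

lemma polynomial_on_det_operator_det:
  assumes "n > 0" and A: "\<And>x a b. a < k \<Longrightarrow> b < k \<Longrightarrow> A x a b \<in> carrier_mat n n"
    and poly: "\<And>a b i j. a < k \<Longrightarrow> b < k \<Longrightarrow> i < n \<Longrightarrow> j < n \<Longrightarrow> polynomial_on r (\<lambda>x. A x a b $$ (i, j))"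
  shows "polynomial_on r (\<lambda>x. det (operator_det k n (A x)))"
proof (rule polynomial_on_det)
  show "operator_det k n (A x) \<in> carrier_mat (n ^ k) (n ^ k)" for x
    using A by (rule operator_det_carrier)
  fix I J assume "I < n ^ k" "J < n ^ k"
  then have "operator_det k n (A x) $$ (I, J) =
    det (mat k k (\<lambda>(a, b). A x a b $$ (digit n k a I, digit n k a J)))" for x
    using A \<open>n > 0\<close> by (intro operator_det_index)
  moreover have "polynomial_on r (\<lambda>x. det (mat k k (\<lambda>(a, b). A x a b $$ (digit n k a I, digit n k a J))))"
    using poly digit_less[OF \<open>n > 0\<close>] by (intro polynomial_on_det) auto
  ultimately show "polynomial_on r (\<lambda>x. operator_det k n (A x) $$ (I, J))" by simp
qed

text \<open>With the left factors frozen, the determinant is a polynomial in the entries of the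
  right ones, nonzero at \<open>B0\<close>. This produces Omega; the mirrored lemma below produces
  Theta.\<close>

lemma generic_mats_operator_det_right:
  assumes "n > 0" and P: "Ps \<in> mat_tuples k n m" and B0: "B0 \<in> mat_tuples k m n"
    and "det (operator_det k n (\<lambda>i j. Ps ! i * B0 ! j)) \<noteq> 0"
  shows "generic_mats k m n {Bs \<in> mat_tuples k m n. det (operator_det k n (\<lambda>i j. Ps ! i * Bs ! j)) \<noteq> 0}"
proof -
  define f where "f x = det (operator_det k n (\<lambda>i j. Ps ! i * mat_of_coords m n j x))" for x
  note Pc = mat_tuples_nth[OF P]
  have f: "f (vec_of_mats k m n Bs) = det (operator_det k n (\<lambda>i j. Ps ! i * Bs ! j))"
    if "Bs \<in> mat_tuples k m n" for Bs
    unfolding f_def using P that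
    by (intro arg_cong[of _ _ det] operator_det_cong)
      (auto simp: mat_of_coords_vec_of_mats intro!: mult_carrier_mat[where n = m] mat_tuples_nth)
  have "polynomial_on (k * (m * n)) f"
    unfolding f_def using \<open>n > 0\<close>
    by (intro polynomial_on_det_operator_det polynomial_on_mat_mult[where p = n and q = m and s = n]
        mult_carrier_mat[where n = m] polynomial_on_const polynomial_on_mat_of_coords Pc mat_of_coords_carrier)
  then have "generic_mats k m n {Bs \<in> mat_tuples k m n. f (vec_of_mats k m n Bs) \<noteq> 0}"
    using B0 assms(4) f by (intro generic_mats_nonvanishing[where ?M0.0 = B0]) auto
  also have "{Bs \<in> mat_tuples k m n. f (vec_of_mats k m n Bs) \<noteq> 0} =
      {Bs \<in> mat_tuples k m n. det (operator_det k n (\<lambda>i j. Ps ! i * Bs ! j)) \<noteq> 0}"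
    using f by auto
  finally show ?thesis .
qed

lemma generic_mats_operator_det_left:
  assumes "n > 0" and B: "Bs \<in> mat_tuples k m n" and P0: "P0 \<in> mat_tuples k n m"
    and "det (operator_det k n (\<lambda>i j. P0 ! i * Bs ! j)) \<noteq> 0"
  shows "generic_mats k n m {Ps \<in> mat_tuples k n m. det (operator_det k n (\<lambda>i j. Ps ! i * Bs ! j)) \<noteq> 0}"
proof -
  define f where "f x = det (operator_det k n (\<lambda>i j. mat_of_coords n m i x * Bs ! j))" for x
  note Bc = mat_tuples_nth[OF B]
  have f: "f (vec_of_mats k n m Ps) = det (operator_det k n (\<lambda>i j. Ps ! i * Bs ! j))"
    if "Ps \<in> mat_tuples k n m" for Ps
    unfolding f_def using B that
    by (intro arg_cong[of _ _ det] operator_det_cong)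
      (auto simp: mat_of_coords_vec_of_mats intro!: mult_carrier_mat[where n = m] mat_tuples_nth)
  have "polynomial_on (k * (n * m)) f"
    unfolding f_def using \<open>n > 0\<close>
    by (intro polynomial_on_det_operator_det polynomial_on_mat_mult[where p = n and q = m and s = n]
        mult_carrier_mat[where n = m] polynomial_on_const polynomial_on_mat_of_coords Bc mat_of_coords_carrier)
  then have "generic_mats k n m {Ps \<in> mat_tuples k n m. f (vec_of_mats k n m Ps) \<noteq> 0}"
    using P0 assms(4) f by (intro generic_mats_nonvanishing[where ?M0.0 = P0]) auto
  also have "{Ps \<in> mat_tuples k n m. f (vec_of_mats k n m Ps) \<noteq> 0} =
      {Ps \<in> mat_tuples k n m. det (operator_det k n (\<lambda>i j. Ps ! i * Bs ! j)) \<noteq> 0}"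
    using f by auto
  finally show ?thesis .
qed

section \<open>A pair of tuples with nonsingular operator determinant\<close>

lemma operator_det_nonzero_witness:
  assumes "n > 0" and m: "m = n + k - 1"
  obtains Ps Bs :: "complex mat list" where
    "Ps \<in> mat_tuples k n m" "Bs \<in> mat_tuples k m n" "det (operator_det k n (\<lambda>i j. Ps ! i * Bs ! j)) \<noteq> 0"
proof
  \<comment> \<open>Division by \<open>n\<close> recovers \<open>i\<close> and \<open>r < n\<close>
    from \<open>i * n + r\<close>, so these nodes are distinct complex numbers.\<close>
  define t :: "nat \<Rightarrow> nat \<Rightarrow> complex" where "t i r = of_nat (i * n + r)" for i r
  define P where "P i = mat n m (\<lambda>(r, c). t i r ^ c)" for i
  \<comment> \<open>Right multiplication by \<open>B j\<close> selects the \<open>n\<close>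
    consecutive columns starting at column \<open>j\<close>.\<close>
  define B :: "nat \<Rightarrow> complex mat" where "B j = mat m n (\<lambda>(c, s). if c = s + j then 1 else 0)" for j
  let ?Ps = "map P [0..<k]" and ?Bs = "map B [0..<k]"
  show "?Ps \<in> mat_tuples k n m" "?Bs \<in> mat_tuples k m n"
    by (auto simp: mat_tuples_def P_def B_def)
  have "inj_on (case_prod t) ({..<k} \<times> {..<n})"
  proof (rule inj_onI, clarsimp simp: t_def simp del: of_nat_add of_nat_mult)
    fix i r i' r' assume r: "r < n" "r' < n" and eq: "i * n + r = i' * n + r'"
    have "(i * n + r) div n = i" "(i * n + r) mod n = r"
      "(i' * n + r') div n = i'" "(i' * n + r') mod n = r'" using r by simp_all
    then show "i = i' \<and> r = r'" unfolding eq by simp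
  qed
  moreover have "operator_det k n (\<lambda>i j. ?Ps ! i * ?Bs ! j) =
    operator_det k n (\<lambda>i j. mat n n (\<lambda>(r, s). t i r ^ (s + j)))"
  proof (rule operator_det_cong)
    fix i j assume ij: "i < k" "j < k"
    show "?Ps ! i * ?Bs ! j \<in> carrier_mat n n"
      using ij by (auto simp: P_def B_def)
    have "(P i * B j) $$ (r, s) = t i r ^ (s + j)" if "r < n" "s < n" for r s
    proof -
      have "(P i * B j) $$ (r, s) = (\<Sum>c = 0..<m. t i r ^ c * (if c = s + j then 1 else 0))"
        using that by (simp add: P_def B_def scalar_prod_def)
      also have "\<dots> = (\<Sum>c = 0..<m. if c = s + j then t i r ^ c else 0)"
        by (intro sum.cong) auto
      \<comment> \<open>The index is in range: \<open>s + j\<close> is at most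
        \<open>n + k - 2\<close>, the last column of \<open>P i\<close>.\<close>
      also have "\<dots> = t i r ^ (s + j)" using that ij m by simp
      finally show ?thesis .
    qed
    then have "P i * B j = mat n n (\<lambda>(r, s). t i r ^ (s + j))"
      by (intro eq_matI) (auto simp: P_def B_def)
    then show "?Ps ! i * ?Bs ! j = mat n n (\<lambda>(r, s). t i r ^ (s + j))"
      using ij by simp
  qed
  ultimately show "det (operator_det k n (\<lambda>i j. ?Ps ! i * ?Bs ! j)) \<noteq> 0"
    using det_operator_det_vandermonde_nonzero[OF \<open>n > 0\<close>] by simp
qed

text \<open>A nonzero \<open>x\<close> killed by the combination gives a relation between the
  vectors \<open>Bs ! b *\<^sub>v x\<close>. Applying each \<open>Ps ! a\<close> to it gives the
  hypothesis of \<open>det_operator_det_zero\<close>, with the same coefficients \<open>l\<close>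
  for all \<open>a\<close>.\<close>

lemma rank_pencil_full:
  assumes "n > 0" and P: "Ps \<in> mat_tuples k n m" and B: "Bs \<in> mat_tuples k m n"
    and nz: "det (operator_det k n (\<lambda>i j. Ps ! i * Bs ! j)) \<noteq> (0 :: 'a :: field)"
    and l: "l \<in> carrier_vec k" "l \<noteq> 0\<^sub>v k"
  shows "vec_space.rank m (finsum_mat TYPE('a) m n (\<lambda>i. l $ i \<cdot>\<^sub>m Bs ! i) {..<k}) = n"
proof (rule rank_eq_dim_col)
  let ?L = "finsum_mat TYPE('a) m n (\<lambda>i. l $ i \<cdot>\<^sub>m Bs ! i) {..<k}"
  note Pc = mat_tuples_nth[OF P] and Bc = mat_tuples_nth[OF B]
  have L0: "?L \<in> carrier_mat m n \<and> (\<forall>i<m. \<forall>j<n. ?L $$ (i, j) = (\<Sum>b<k. (l $ b \<cdot>\<^sub>m Bs ! b) $$ (i, j)))"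
    using Bc by (intro finsum_mat_carrier_index) auto
  then show L: "?L \<in> carrier_mat m n" ..
  have L_index: "?L $$ (i, j) = (\<Sum>b<k. l $ b * Bs ! b $$ (i, j))" if "i < m" "j < n" for i j
  proof -
    have "(l $ b \<cdot>\<^sub>m Bs ! b) $$ (i, j) = l $ b * Bs ! b $$ (i, j)" if "b < k" for b
      using carrier_matD[OF Bc[OF that]] \<open>i < m\<close> \<open>j < n\<close> by simp
    then show ?thesis using L0 that by simp
  qed
  fix x assume x: "x \<in> carrier_vec n" and Lx: "?L *\<^sub>v x = 0\<^sub>v m"
  show "x = 0\<^sub>v n"
  proof (rule ccontr)
    assume "x \<noteq> 0\<^sub>v n"
    have Bx: "(\<Sum>b<k. l $ b * (Bs ! b *\<^sub>v x) $ c) = 0" if "c < m" for c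
    proof -
      have "(\<Sum>b<k. l $ b * (Bs ! b *\<^sub>v x) $ c) = (\<Sum>b<k. \<Sum>s = 0..<n. l $ b * Bs ! b $$ (c, s) * x $ s)"
      proof (rule sum.cong[OF refl])
        fix b assume "b \<in> {..<k}"
        then show "l $ b * (Bs ! b *\<^sub>v x) $ c = (\<Sum>s = 0..<n. l $ b * Bs ! b $$ (c, s) * x $ s)"
          using that x carrier_matD[OF Bc[of b]] by (simp add: scalar_prod_def sum_distrib_left mult.assoc)
      qed
      also have "\<dots> = (\<Sum>s = 0..<n. ?L $$ (c, s) * x $ s)"
        using that by (subst sum.swap) (simp add: L_index sum_distrib_right)
      also have "\<dots> = (?L *\<^sub>v x) $ c"
        using that x L by (simp add: scalar_prod_def)
      finally show ?thesis unfolding Lx using that by simp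
    qed
    have "(\<Sum>b<k. ((Ps ! a * Bs ! b) *\<^sub>v x) $ r * l $ b) = 0" if "a < k" "r < n" for a r
    proof -
      have "(\<Sum>b<k. ((Ps ! a * Bs ! b) *\<^sub>v x) $ r * l $ b) =
        (\<Sum>b<k. \<Sum>c = 0..<m. Ps ! a $$ (r, c) * (l $ b * (Bs ! b *\<^sub>v x) $ c))"
      proof (intro sum.cong refl)
        fix b assume "b \<in> {..<k}"
        then have "b < k" by simp
        then have "(Ps ! a * Bs ! b) *\<^sub>v x = Ps ! a *\<^sub>v (Bs ! b *\<^sub>v x)"
          using Pc[OF that(1)] Bc x by (intro assoc_mult_mat_vec) auto
        then have "((Ps ! a * Bs ! b) *\<^sub>v x) $ r = (\<Sum>c = 0..<m. Ps ! a $$ (r, c) * (Bs ! b *\<^sub>v x) $ c)"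
          using Pc[OF that(1)] Bc[OF \<open>b < k\<close>] that by (simp add: scalar_prod_def[of _ "Bs ! b *\<^sub>v x"] del: index_mult_mat_vec(1) add: index_mult_mat_vec(1)[of r "Ps ! a"])
        then show "((Ps ! a * Bs ! b) *\<^sub>v x) $ r * l $ b =
          (\<Sum>c = 0..<m. Ps ! a $$ (r, c) * (l $ b * (Bs ! b *\<^sub>v x) $ c))"
          by (simp add: sum_distrib_left mult_ac)
      qed
      also have "\<dots> = (\<Sum>c = 0..<m. Ps ! a $$ (r, c) * (\<Sum>b<k. l $ b * (Bs ! b *\<^sub>v x) $ c))"
        by (subst sum.swap) (simp add: sum_distrib_left)
      finally show ?thesis by (simp add: Bx)
    qed
    then have "det (operator_det k n (\<lambda>i j. Ps ! i * Bs ! j)) = 0"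
      using \<open>n > 0\<close> Pc Bc x \<open>x \<noteq> 0\<^sub>v n\<close> l
      by (intro det_operator_det_zero[where x = x and l = l]) (auto intro: mult_carrier_mat[where n = m])
    then show False using nz by simp
  qed
qed

theorem theorem1:
  fixes n k :: nat
  assumes "n \<ge> 1" and "k \<ge> 2"
  shows "\<exists>\<Omega> :: complex mat list set.
    generic_mats k (n + k - 1) n \<Omega> \<and>
    (\<forall>Bs \<in> \<Omega>. \<exists>\<Theta> :: complex mat list set.
       generic_mats k n (n + k - 1) \<Theta> \<and>
       (\<forall>Ps \<in> \<Theta>. invertible_mat (operator_det k n (\<lambda>i j. Ps ! i * Bs ! j)))) \<and>
    (\<forall>Bs \<in> \<Omega>. \<forall>l \<in> carrier_vec k. l \<noteq> 0\<^sub>v k \<longrightarrow>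
       vec_space.rank (n + k - 1)
         (finsum_mat TYPE(complex) (n + k - 1) n (\<lambda>i. l $ i \<cdot>\<^sub>m Bs ! i) {..<k}) = n)"
proof -
  define m where "m = n + k - 1"
  have n: "n > 0" using assms by simp
  obtain P0 B0 where P0: "P0 \<in> mat_tuples k n m" and B0: "B0 \<in> mat_tuples k m n"
    and nz: "det (operator_det k n (\<lambda>i j. P0 ! i * B0 ! j)) \<noteq> (0 :: complex)"
    using operator_det_nonzero_witness[OF n m_def] by blast
  let ?\<Omega> = "{Bs \<in> mat_tuples k m n. det (operator_det k n (\<lambda>i j. P0 ! i * Bs ! j)) \<noteq> 0}"
  let ?\<Theta> = "\<lambda>Bs. {Ps \<in> mat_tuples k n m. det (operator_det k n (\<lambda>i j. Ps ! i * Bs ! j)) \<noteq> 0}"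
  have "generic_mats k m n ?\<Omega>"
    using generic_mats_operator_det_right[OF n P0 B0 nz] .
  \<comment> \<open>Membership in \<open>?\<Omega>\<close> says exactly that \<open>P0\<close> is a
    point where the polynomial behind \<open>?\<Theta> Bs\<close> is nonzero.\<close>
  moreover have "generic_mats k n m (?\<Theta> Bs)" if "Bs \<in> ?\<Omega>" for Bs
    using generic_mats_operator_det_left[OF n _ P0] that by simp
  moreover have "invertible_mat (operator_det k n (\<lambda>i j. Ps ! i * Bs ! j))"
    if "Bs \<in> ?\<Omega>" "Ps \<in> ?\<Theta> Bs" for Bs Ps
  proof (rule det_nonzero_invertible_mat)
    have "Ps ! i * Bs ! j \<in> carrier_mat n n" if "i < k" "j < k" for i j
    proof (rule mult_carrier_mat)
      show "Ps ! i \<in> carrier_mat n m" "Bs ! j \<in> carrier_mat m n"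
        using \<open>Ps \<in> ?\<Theta> Bs\<close> \<open>Bs \<in> ?\<Omega>\<close> that by (auto simp: mat_tuples_def)
    qed
    then show "operator_det k n (\<lambda>i j. Ps ! i * Bs ! j) \<in> carrier_mat (n ^ k) (n ^ k)"
      by (rule operator_det_carrier)
  qed (use that in simp)
  moreover have "vec_space.rank m (finsum_mat TYPE(complex) m n (\<lambda>i. l $ i \<cdot>\<^sub>m Bs ! i) {..<k}) = n"
    if "Bs \<in> ?\<Omega>" "l \<in> carrier_vec k" "l \<noteq> 0\<^sub>v k" for Bs l
    using that by (intro rank_pencil_full[OF n P0]) auto
  ultimately show ?thesis
    unfolding m_def[symmetric] by (intro exI[of _ ?\<Omega>]) blast
qed

end
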